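(* Let $n>1$ and let $\mathcal{F}_n$ be the $k$-vector space with basis $\{U_{ij}:1\le i,j\le n\}$. For $\alpha\in\{0,\dots,n-1\}$ let $\Delta_{[\alpha]}:\mathcal{F}_n\to\mathcal{F}_n^{\otimes 2}$ be the linear map $\Delta_{[\alpha]}U_{ij}=\sum_{k=1}^n U_{i\,p^\alpha(k)}\otimes U_{kj}$, where $p$ is the cyclic shift on $\{1,\dots,n\}$. Then each $\Delta_{[\alpha]}$ is coassociative. Moreover, for all $\alpha,\beta\in\{0,\dots,n-1\}$, $\Delta_{[\alpha]}$ and $\Delta_{[\beta]}$ obey the entanglement equation $$(\Delta_{[\alpha]}\otimes id)\Delta_{[\beta]}=(id\otimes\Delta_{[\beta]})\Delta_{[\alpha]}.$$
   Context: The field $k$ is $\mathbb{R}$ or $\mathbb{C}$. The shift $p:\{1,\dots,n\}\to\{1,\dots,n\}$ sends $j$ to $j+1$ modulo $n$ (so $p(n)=1$). A linear map $\Delta:C\to C\otimes C$ is coassociative if $(\Delta\otimes id)\Delta=(id\otimes\Delta)\Delta$; no counit is required. The coproduct is given in the paper by the matrix notation $\Delta_{[\alpha]}U_{ij}=\bigl(\mathcal{P}^\alpha(\mathcal{P}^\alpha(U)\bar\otimes\mathcal{P}^{-\alpha}(U))\bigr)_{ij}=(\mathcal{P}^\alpha(U)\bar\otimes U)_{ij}$, where $U=(U_{ij})$, $\mathcal{P}^{\pm\alpha}(U)_{ij}=U_{i\,p^{\pm\alpha}(j)}$ and $(V\bar\otimes W)_{ij}=\sum_k V_{ik}\otimes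 W_{kj}$; this is the explicit formula in the claim. *)

theory Defs
  imports Complex_Main "HOL-Library.Poly_Mapping"
begin

abbreviation "lookup \<equiv> Poly_Mapping.lookup"
abbreviation "keys \<equiv> Poly_Mapping.keys"
abbreviation "single \<equiv> Poly_Mapping.single"

text \<open>
  The definitions are over an arbitrary field; \<open>real\<close> and \<open>complex\<close> are the instances of interest.
\<close>

section \<open>Free vector spaces and linear extension\<close>

text \<open>
  The finitely supported functions \<open>'a \<Rightarrow>\<^sub>0 'k\<close> form the free \<open>'k\<close>-vector space on
  the type \<open>'a\<close>, with basis vectors \<open>single a 1\<close>.
\<close>

lift_definition smul :: "'k \<Rightarrow> ('a \<Rightarrow>\<^sub>0 'k) \<Rightarrow> ('a \<Rightarrow>\<^sub>0 'k::field)" (infixr "*\<^sub>k" 75)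
  is "\<lambda>c f a. c * f a"
  by (rule finite_subset) auto

lemma lookup_smul [simp]: "lookup (c *\<^sub>k x) a = c * lookup x a"
  by transfer simp

global_interpretation pm: vector_space "smul :: 'k::field \<Rightarrow> ('a \<Rightarrow>\<^sub>0 'k) \<Rightarrow> ('a \<Rightarrow>\<^sub>0 'k)"
  by unfold_locales (auto intro!: poly_mapping_eqI simp: lookup_add algebra_simps)

text \<open>The linear map with prescribed values on the basis vectors \<open>single a 1\<close>.\<close>

definition lin_ext :: "('a \<Rightarrow> ('b \<Rightarrow>\<^sub>0 'k)) \<Rightarrow> ('a \<Rightarrow>\<^sub>0 'k) \<Rightarrow> ('b \<Rightarrow>\<^sub>0 'k::field)" where
  "lin_ext f x = (\<Sum>a\<in>keys x. lookup x a *\<^sub>k f a)"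

text \<open>The subspace spanned by the basis vectors indexed by \<open>B\<close>.\<close>

definition free_on :: "'a set \<Rightarrow> ('a \<Rightarrow>\<^sub>0 'k::field) set" where
  "free_on B = {x. keys x \<subseteq> B}"

lemma sum_keys_superset:
  assumes "vector_space s" "finite A" "keys x \<subseteq> A"
  shows "(\<Sum>a\<in>keys x. s (lookup x a) (g a)) = (\<Sum>a\<in>A. s (lookup x a) (g a))"
proof -
  interpret vector_space s by fact
  show ?thesis
    using assms(2,3) by (intro sum.mono_neutral_left) (auto simp: in_keys_iff)
qed

lemma keys_smul_subset: "keys (c *\<^sub>k x) \<subseteq> keys x"
  by (auto simp: in_keys_iff)

lemma linear_sum_keys:
  fixes s :: "'k::field \<Rightarrow> 'v::ab_group_add \<Rightarrow> 'v" and g :: "'a \<Rightarrow> 'v"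
  assumes "vector_space s"
  shows "Vector_Spaces.linear smul s (\<lambda>x. \<Sum>a\<in>keys x. s (lookup x a) (g a))"
proof -
  interpret S: vector_space s by fact
  show ?thesis
    unfolding Vector_Spaces.linear_iff
  proof (intro conjI allI assms pm.vector_space_axioms)
    fix x y :: "'a \<Rightarrow>\<^sub>0 'k"
    let ?A = "keys x \<union> keys y"
    have "keys (x + y) \<subseteq> ?A" by (rule keys_add)
    then show "(\<Sum>a\<in>keys (x + y). s (lookup (x + y) a) (g a)) =
        (\<Sum>a\<in>keys x. s (lookup x a) (g a)) + (\<Sum>a\<in>keys y. s (lookup y a) (g a))"
      by (subst (1 2 3) sum_keys_superset[OF assms, of ?A])
        (auto simp: lookup_add S.scale_left_distrib sum.distrib)
  next
    fix c and x :: "'a \<Rightarrow>\<^sub>0 'k"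
    show "(\<Sum>a\<in>keys (c *\<^sub>k x). s (lookup (c *\<^sub>k x) a) (g a)) =
        s c (\<Sum>a\<in>keys x. s (lookup x a) (g a))"
      by (subst sum_keys_superset[OF assms finite_keys keys_smul_subset])
        (simp add: S.scale_sum_right)
  qed
qed

lemma linear_lin_ext: "Vector_Spaces.linear smul smul (lin_ext f)"
  unfolding lin_ext_def by (rule linear_sum_keys) unfold_locales

lemma lin_ext_single [simp]: "lin_ext f (single a 1) = f a"
  by (simp add: lin_ext_def)

lemma expand_basis: "x = (\<Sum>a\<in>keys x. lookup x a *\<^sub>k single a 1)"
proof (rule poly_mapping_eqI)
  fix b
  have "lookup (\<Sum>a\<in>keys x. lookup x a *\<^sub>k single a 1) b =
      (\<Sum>a\<in>keys x. if a = b then lookup x a else 0)"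
    unfolding lookup_sum by (intro sum.cong) (auto simp: lookup_single when_def)
  also have "\<dots> = lookup x b"
    by (auto simp: in_keys_iff)
  finally show "lookup x b = lookup (\<Sum>a\<in>keys x. lookup x a *\<^sub>k single a 1) b" ..
qed

lemma free_on_eq_span: "free_on B = pm.span ((\<lambda>a. single a (1::'k::field)) ` B)"
proof
  show "free_on B \<subseteq> pm.span ((\<lambda>a. single a (1::'k)) ` B)"
  proof
    fix x :: "_ \<Rightarrow>\<^sub>0 'k" assume "x \<in> free_on B"
    then have "(\<Sum>a\<in>keys x. lookup x a *\<^sub>k single a 1) \<in> pm.span ((\<lambda>a. single a 1) ` B)"
      by (intro pm.span_sum pm.span_scale pm.span_base) (auto simp: free_on_def)
    then show "x \<in> pm.span ((\<lambda>a. single a 1) ` B)"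
      by (simp flip: expand_basis)
  qed
  have "pm.subspace (free_on B :: (_ \<Rightarrow>\<^sub>0 'k) set)"
    unfolding pm.subspace_def free_on_def
    by (auto dest!: subsetD[OF keys_add] subsetD[OF keys_smul_subset])
  then show "pm.span ((\<lambda>a. single a (1::'k)) ` B) \<subseteq> free_on B"
    by (rule pm.span_minimal[rotated]) (auto simp: free_on_def)
qed

lemma independent_basis: "pm.independent ((\<lambda>a. single a (1::'k::field)) ` B)"
  unfolding pm.dependent_def
proof clarify
  fix a assume "a \<in> B"
    and *: "single a (1::'k) \<in> pm.span ((\<lambda>a. single a 1) ` B - {single a 1})"
  have "(\<lambda>a. single a (1::'k)) ` B - {single a 1} \<subseteq> (\<lambda>a. single a 1) ` (B - {a})"
    by auto
  with * have "single a (1::'k) \<in> free_on (B - {a})"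
    unfolding free_on_eq_span using pm.span_mono by blast
  then show False by (simp add: free_on_def)
qed

section \<open>Tensor products\<close>

text \<open>
  The tensor product of the free vector spaces on \<open>'a\<close> and \<open>'b\<close> is realised as the free
  vector space on \<open>'a \<times> 'b\<close>; \<open>tensor_universal\<close> below is its universal property.
\<close>

lift_definition tensor :: "('a \<Rightarrow>\<^sub>0 'k) \<Rightarrow> ('b \<Rightarrow>\<^sub>0 'k) \<Rightarrow> ('a \<times> 'b \<Rightarrow>\<^sub>0 'k::field)"
    (infixr "\<otimes>" 76) is "\<lambda>x y (a, b). x a * y b"
proof -
  fix x :: "'a \<Rightarrow> 'k" and y :: "'b \<Rightarrow> 'k"
  assume "finite {a. x a \<noteq> 0}" "finite {b. y b \<noteq> 0}"
  then have "finite ({a. x a \<noteq> 0} \<times> {b. y b \<noteq> 0})" by (rule finite_cartesian_product)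
  then show "finite {c. (case c of (a, b) \<Rightarrow> x a * y b) \<noteq> 0}"
    by (rule rev_finite_subset) auto
qed

lemma lookup_tensor: "lookup (x \<otimes> y) c = lookup x (fst c) * lookup y (snd c)"
  by transfer (simp add: case_prod_beta)

lemma tensor_single: "single a c \<otimes> single b d = single (a, b) (c * d :: 'k::field)"
  by (rule poly_mapping_eqI) (auto simp: lookup_tensor lookup_single when_def prod_eq_iff)

lemma linear_tensor_left: "Vector_Spaces.linear smul smul (\<lambda>x. x \<otimes> y)"
  and linear_tensor_right: "Vector_Spaces.linear smul smul (\<lambda>y. x \<otimes> y)"
  unfolding Vector_Spaces.linear_iff
  by (auto intro!: poly_mapping_eqI simp: lookup_tensor lookup_add algebra_simps pm.vector_space_axioms)

lemma tensor_universal: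
  fixes s :: "'k::field \<Rightarrow> 'v::ab_group_add \<Rightarrow> 'v"
    and \<beta> :: "('a \<Rightarrow>\<^sub>0 'k) \<Rightarrow> ('b \<Rightarrow>\<^sub>0 'k) \<Rightarrow> 'v"
  assumes "vector_space s"
    and left: "\<And>y. Vector_Spaces.linear smul s (\<lambda>x. \<beta> x y)"
    and right: "\<And>x. Vector_Spaces.linear smul s (\<beta> x)"
  shows "\<exists>!L. Vector_Spaces.linear smul s L \<and> (\<forall>x y. L (x \<otimes> y) = \<beta> x y)"
proof -
  interpret S: vector_space s by fact
  have expand: "M x = (\<Sum>a\<in>keys x. s (lookup x a) (M (single a 1)))"
    if "Vector_Spaces.linear smul s M" for M and x :: "'c \<Rightarrow>\<^sub>0 'k"
  proof -
    interpret M: Vector_Spaces.linear smul s M by fact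
    have "M x = M (\<Sum>a\<in>keys x. lookup x a *\<^sub>k single a 1)"
      by (simp flip: expand_basis)
    then show ?thesis by (simp add: M.sum M.scale)
  qed
  define L where "L z = (\<Sum>c\<in>keys z. s (lookup z c) (\<beta> (single (fst c) 1) (single (snd c) 1)))"
    for z :: "'a \<times> 'b \<Rightarrow>\<^sub>0 'k"
  have lin: "Vector_Spaces.linear smul s L"
    unfolding L_def by (rule linear_sum_keys) fact
  have ext: "L (x \<otimes> y) = \<beta> x y" for x y
  proof -
    have "keys (x \<otimes> y) \<subseteq> keys x \<times> keys y"
      by (auto simp: in_keys_iff lookup_tensor)
    then have "L (x \<otimes> y) = (\<Sum>c\<in>keys x \<times> keys y.
        s (lookup (x \<otimes> y) c) (\<beta> (single (fst c) 1) (single (snd c) 1)))"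
      unfolding L_def by (intro sum_keys_superset[OF assms(1)]) auto
    also have "\<dots> = (\<Sum>a\<in>keys x. \<Sum>b\<in>keys y.
        s (lookup x a * lookup y b) (\<beta> (single a 1) (single b 1)))"
      by (simp add: sum.cartesian_product case_prod_beta lookup_tensor)
    also have "\<dots> = (\<Sum>a\<in>keys x. s (lookup x a) (\<beta> (single a 1) y))"
      by (intro sum.cong refl, subst (2) expand[OF right]) (simp add: S.scale_sum_right)
    also have "\<dots> = \<beta> x y"
      by (rule expand[OF left, symmetric])
    finally show ?thesis .
  qed
  show ?thesis
  proof (intro ex1I conjI allI)
    show "Vector_Spaces.linear smul s L" by fact
    show "L (x \<otimes> y) = \<beta> x y" for x y by (rule ext)
    fix M assume M: "Vector_Spaces.linear smul s M \<and> (\<forall>x y. M (x \<otimes> y) = \<beta> x y)"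
    have "M (single c 1) = L (single c 1)" for c
    proof -
      have "single c (1::'k) = single (fst c) 1 \<otimes> single (snd c) 1"
        by (simp add: tensor_single)
      then show ?thesis using M ext by metis
    qed
    then show "M = L"
      by (subst fun_eq_iff, subst expand[OF conjunct1[OF M]], subst expand[OF lin]) simp
  qed
qed

text \<open>For linear \<open>f\<close> and \<open>g\<close>, this is \<open>f \<otimes> g\<close>; see \<open>tensor_map_tensor\<close> below.\<close>

definition tensor_map ::
    "(('a \<Rightarrow>\<^sub>0 'k) \<Rightarrow> ('c \<Rightarrow>\<^sub>0 'k)) \<Rightarrow> (('b \<Rightarrow>\<^sub>0 'k) \<Rightarrow> ('d \<Rightarrow>\<^sub>0 'k)) \<Rightarrow>
     ('a \<times> 'b \<Rightarrow>\<^sub>0 'k) \<Rightarrow> ('c \<times> 'd \<Rightarrow>\<^sub>0 'k::field)" where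
  "tensor_map f g = lin_ext (\<lambda>(a, b). f (single a 1) \<otimes> g (single b 1))"

text \<open>The canonical identification \<open>(x \<otimes> y) \<otimes> z \<mapsto> x \<otimes> (y \<otimes> z)\<close>, usually left implicit.\<close>

definition assoc :: "(('a \<times> 'b) \<times> 'c \<Rightarrow>\<^sub>0 'k) \<Rightarrow> ('a \<times> ('b \<times> 'c) \<Rightarrow>\<^sub>0 'k::field)" where
  "assoc = lin_ext (\<lambda>((a, b), c). single (a, (b, c)) 1)"

lemma linear_tensor_map: "Vector_Spaces.linear smul smul (tensor_map f g)"
  and linear_assoc: "Vector_Spaces.linear smul smul assoc"
  unfolding tensor_map_def assoc_def by (rule linear_lin_ext)+

lemma linear_eq_on_basis:
  assumes f: "Vector_Spaces.linear smul smul f" and g: "Vector_Spaces.linear smul smul g"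
    and "\<And>a. f (single a 1) = g (single a 1)"
  shows "f x = g x"
proof -
  interpret f: Vector_Spaces.linear smul smul f by fact
  interpret g: Vector_Spaces.linear smul smul g by fact
  have "f (\<Sum>a\<in>keys x. lookup x a *\<^sub>k single a 1) = g (\<Sum>a\<in>keys x. lookup x a *\<^sub>k single a 1)"
    by (simp add: f.sum g.sum f.scale g.scale assms(3))
  then show ?thesis by (simp flip: expand_basis)
qed

lemma linear_comp:
  assumes "Vector_Spaces.linear smul smul f" "Vector_Spaces.linear smul smul g"
  shows "Vector_Spaces.linear smul smul (\<lambda>x. f (g x))"
  using Vector_Spaces.linear_compose[OF assms(2,1)] by (simp add: o_def)

lemma tensor_map_tensor:
  assumes f: "Vector_Spaces.linear smul smul f" and g: "Vector_Spaces.linear smul smul g"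
  shows "tensor_map f g (x \<otimes> y) = f x \<otimes> g y"
proof -
  have 0: "tensor_map f g (single a 1 \<otimes> single b 1) = f (single a 1) \<otimes> g (single b 1)" for a b
    by (simp add: tensor_map_def tensor_single)
  have 1: "tensor_map f g (single a 1 \<otimes> y) = f (single a 1) \<otimes> g y" for a
    by (rule linear_eq_on_basis[where x = y, OF linear_comp[OF linear_tensor_map linear_tensor_right]
          linear_comp[OF linear_tensor_right g] 0])
  show ?thesis
    by (rule linear_eq_on_basis[where x = x, OF linear_comp[OF linear_tensor_map linear_tensor_left]
          linear_comp[OF linear_tensor_left f] 1])
qed

lemma assoc_tensor:
  fixes x :: "'a \<Rightarrow>\<^sub>0 'k::field" and y :: "'b \<Rightarrow>\<^sub>0 'k" and z :: "'c \<Rightarrow>\<^sub>0 'k"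
  shows "assoc ((x \<otimes> y) \<otimes> z) = x \<otimes> (y \<otimes> z)"
proof -
  have 0: "assoc ((single a 1 \<otimes> single b 1) \<otimes> single c (1::'k)) =
      single a 1 \<otimes> (single b 1 \<otimes> single c 1)" for a :: 'a and b :: 'b and c :: 'c
    by (simp add: assoc_def tensor_single)
  have 1: "assoc ((single a 1 \<otimes> single b 1) \<otimes> z) = single a 1 \<otimes> (single b 1 \<otimes> z)"
    for a :: 'a and b :: 'b and z :: "'c \<Rightarrow>\<^sub>0 'k"
    by (rule linear_eq_on_basis[where x = z, OF linear_comp[OF linear_assoc linear_tensor_right]
          linear_comp[OF linear_tensor_right linear_tensor_right] 0])
  have 2: "assoc ((single a 1 \<otimes> y) \<otimes> z) = single a 1 \<otimes> (y \<otimes> z)"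
    for a :: 'a and y :: "'b \<Rightarrow>\<^sub>0 'k" and z :: "'c \<Rightarrow>\<^sub>0 'k"
    by (rule linear_eq_on_basis[where x = y,
          OF linear_comp[OF linear_assoc linear_comp[OF linear_tensor_left linear_tensor_right]]
          linear_comp[OF linear_tensor_right linear_tensor_left] 1])
  show ?thesis
    by (rule linear_eq_on_basis[where x = x,
          OF linear_comp[OF linear_assoc linear_comp[OF linear_tensor_left linear_tensor_left]]
          linear_tensor_left 2])
qed

section \<open>Coassociativity and the entanglement equation\<close>

text \<open>
  Here \<open>C\<close> is meant to be a space \<open>free_on B\<close>, and \<open>D\<close>, \<open>D1\<close>, \<open>D2\<close> linear maps that send
  \<open>C\<close> to \<open>C \<otimes> C\<close>; for \<open>x \<in> C\<close> their values outside \<open>C\<close> do not enter the equations.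
\<close>

definition coassociative ::
    "('a \<Rightarrow>\<^sub>0 'k::field) set \<Rightarrow> (('a \<Rightarrow>\<^sub>0 'k) \<Rightarrow> ('a \<times> 'a \<Rightarrow>\<^sub>0 'k)) \<Rightarrow> bool" where
  "coassociative C D \<longleftrightarrow> (\<forall>x\<in>C. assoc (tensor_map D id (D x)) = tensor_map id D (D x))"

definition entangled ::
    "('a \<Rightarrow>\<^sub>0 'k::field) set \<Rightarrow> (('a \<Rightarrow>\<^sub>0 'k) \<Rightarrow> ('a \<times> 'a \<Rightarrow>\<^sub>0 'k)) \<Rightarrow>
     (('a \<Rightarrow>\<^sub>0 'k) \<Rightarrow> ('a \<times> 'a \<Rightarrow>\<^sub>0 'k)) \<Rightarrow> bool" where
  "entangled C D1 D2 \<longleftrightarrow> (\<forall>x\<in>C. assoc (tensor_map D1 id (D2 x)) = tensor_map id D2 (D1 x))"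

section \<open>The space \<open>F n\<close> and its coproducts\<close>

definition U :: "nat \<Rightarrow> nat \<Rightarrow> (nat \<times> nat \<Rightarrow>\<^sub>0 'k::field)" where
  "U i j = single (i, j) 1"

definition F :: "nat \<Rightarrow> (nat \<times> nat \<Rightarrow>\<^sub>0 'k::field) set" where
  "F n = free_on ({1..n} \<times> {1..n})"

lemma basis_eq_image:
  "{U i j | i j. i \<in> {1..n} \<and> j \<in> {1..n}} =
    (\<lambda>a. single a (1::'k::field)) ` ({1..n} \<times> {1..n})"
  unfolding U_def by blast

lemma F_eq_span: "F n = pm.span {U i j :: _ \<Rightarrow>\<^sub>0 'k::field | i j. i \<in> {1..n} \<and> j \<in> {1..n}}"
  by (simp only: F_def free_on_eq_span basis_eq_image)

lemma independent_U:
  "pm.independent {U i j :: _ \<Rightarrow>\<^sub>0 'k::field | i j. i \<in> {1..n} \<and> j \<in> {1..n}}"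
  unfolding basis_eq_image by (rule independent_basis)

lemma U_eq_iff: "(U i j :: _ \<Rightarrow>\<^sub>0 'k::field) = U i' j' \<longleftrightarrow> i = i' \<and> j = j'"
  by (metis U_def Pair_inject lookup_single_eq lookup_single_not_eq zero_neq_one)

text \<open>The cyclic shift of \<open>{1..n}\<close>: \<open>j\<close> goes to \<open>j + 1\<close> for \<open>j < n\<close>, and \<open>n\<close> goes to \<open>1\<close>.\<close>

definition shift :: "nat \<Rightarrow> nat \<Rightarrow> nat" where
  "shift n j = (if j = n then 1 else j + 1)"

text \<open>
  Being a linear extension, the coproduct is a map on the ambient type; only its restriction to
  \<open>F n\<close> is of interest.
\<close>

definition Delta ::
    "nat \<Rightarrow> nat \<Rightarrow> (nat \<times> nat \<Rightarrow>\<^sub>0 'k) \<Rightarrow> ((nat \<times> nat) \<times> (nat \<times> nat) \<Rightarrow>\<^sub>0 'k::field)" where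
  "Delta n \<alpha> = lin_ext (\<lambda>(i, j). \<Sum>k = 1..n. U i ((shift n ^^ \<alpha>) k) \<otimes> U k j)"

lemma Delta_U: "Delta n \<alpha> (U i j) = (\<Sum>k = 1..n. U i ((shift n ^^ \<alpha>) k) \<otimes> U k j)"
  unfolding Delta_def U_def by simp

lemma linear_Delta: "Vector_Spaces.linear smul smul (Delta n \<alpha>)"
  unfolding Delta_def by (rule linear_lin_ext)

lemma shift_power_in: "k \<in> {1..n} \<Longrightarrow> (shift n ^^ \<alpha>) k \<in> {1..n}"
  by (induction \<alpha>) (auto simp: shift_def)

lemma Delta_in_tensor_square:
  assumes "x \<in> F n"
  shows "Delta n \<alpha> x \<in> pm.span {y \<otimes> z | y z. y \<in> F n \<and> z \<in> F n}"
proof -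
  have U: "U i j \<in> F n" if "i \<in> {1..n}" "j \<in> {1..n}" for i j
    using that by (simp add: U_def F_def free_on_def)
  have "(\<Sum>k = 1..n. U (fst a) ((shift n ^^ \<alpha>) k) \<otimes> U k (snd a))
      \<in> pm.span {y \<otimes> z | y z. y \<in> F n \<and> z \<in> F n}" if "a \<in> keys x" for a
  proof (rule pm.span_sum)
    fix k assume k: "k \<in> {1..n}"
    have "fst a \<in> {1..n}" "snd a \<in> {1..n}"
      using that assms by (auto simp: F_def free_on_def)
    then have "U (fst a) ((shift n ^^ \<alpha>) k) \<in> F n" "U k (snd a) \<in> F n"
      using U k shift_power_in[OF k] by blast+
    then show "U (fst a) ((shift n ^^ \<alpha>) k) \<otimes> U k (snd a)
        \<in> pm.span {y \<otimes> z | y z. y \<in> F n \<and> z \<in> F n}"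
      by (intro pm.span_base) blast
  qed
  then show ?thesis
    unfolding Delta_def lin_ext_def case_prod_beta
    by (intro pm.span_sum[where A = "keys x"] pm.span_scale)
qed

end

theory Submission
  imports Defs
begin

text \<open>
  Both sides of the entanglement equation are linear, so they may be compared on \<open>U i j\<close>. Write
  \<open>s = shift n ^^ \<alpha>\<close> and \<open>t = shift n ^^ \<beta>\<close>. Each side is a double sum whose general term is
  \<open>U i (s l) \<otimes> U l (t k) \<otimes> U k j\<close>: on the left \<open>\<Delta>\<^sub>\<beta>\<close> creates \<open>k\<close> and then \<open>\<Delta>\<^sub>\<alpha>\<close> splits the left
  factor \<open>U i (t k)\<close> at \<open>l\<close>; on the right \<open>\<Delta>\<^sub>\<alpha>\<close> creates \<open>l\<close> and then \<open>\<Delta>\<^sub>\<beta>\<close> splits the right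
  factor \<open>U l j\<close> at \<open>k\<close>. The key is that
  splitting \<open>U i c\<close> hands the row index \<open>i\<close> to its left factor and the column index \<open>c\<close>, be it \<open>j\<close>
  or a twisted \<open>t k\<close>, unchanged to its right factor; only the new middle index is twisted.
  The two sides thus differ only in the order of summation (\<open>Delta_entanglement\<close>), whichever
  self-maps \<open>s\<close> and \<open>t\<close> are. Coassociativity is the case \<open>\<alpha> = \<beta>\<close>.
\<close>

lemma linear_id_smul: "Vector_Spaces.linear smul smul id"
  by (rule pm.linear_id)

lemma linear_sum:
  assumes "Vector_Spaces.linear smul smul f"
  shows "f (\<Sum>a\<in>A. g a) = (\<Sum>a\<in>A. f (g a))"
proof -
  interpret Vector_Spaces.linear smul smul f by fact
  show ?thesis by (rule sum)
qed

lemma tensor_sum_left: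
  "(\<Sum>a\<in>A. f a) \<otimes> y = (\<Sum>a\<in>A. f a \<otimes> y)"
  by (rule linear_sum[OF linear_tensor_left])

lemma tensor_sum_right:
  "x \<otimes> (\<Sum>a\<in>A. f a) = (\<Sum>a\<in>A. x \<otimes> f a)"
  by (rule linear_sum[OF linear_tensor_right])

lemma single_eq_U: "single a 1 = U (fst a) (snd a)"
  by (simp add: U_def)

lemma assoc_Delta_left_U:
  "assoc (tensor_map (Delta n \<alpha>) id (Delta n \<beta> (U i j))) =
    (\<Sum>k = 1..n. \<Sum>l = 1..n.
      U i ((shift n ^^ \<alpha>) l) \<otimes> (U l ((shift n ^^ \<beta>) k) \<otimes> U k j))"
  by (simp add: Delta_U linear_sum[OF linear_tensor_map]
      linear_sum[OF linear_assoc] tensor_map_tensor[OF linear_Delta linear_id_smul]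
      tensor_sum_left assoc_tensor)

lemma Delta_right_U:
  "tensor_map id (Delta n \<beta>) (Delta n \<alpha> (U i j)) =
    (\<Sum>l = 1..n. \<Sum>k = 1..n.
      U i ((shift n ^^ \<alpha>) l) \<otimes> (U l ((shift n ^^ \<beta>) k) \<otimes> U k j))"
  by (simp add: Delta_U linear_sum[OF linear_tensor_map]
      tensor_map_tensor[OF linear_id_smul linear_Delta] tensor_sum_right)

text \<open>
  The equation holds on the whole ambient space: the formula for \<open>Delta n \<alpha> (U i j)\<close> makes sense
  for all indices \<open>i\<close> and \<open>j\<close>, and only the summation indices range over \<open>{1..n}\<close>.
\<close>

lemma Delta_entanglement:
  "assoc (tensor_map (Delta n \<alpha>) id (Delta n \<beta> x)) = tensor_map id (Delta n \<beta>) (Delta n \<alpha> x)"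
proof -
  have basis: "assoc (tensor_map (Delta n \<alpha>) id (Delta n \<beta> (single a 1))) =
      tensor_map id (Delta n \<beta>) (Delta n \<alpha> (single a 1))" for a
    unfolding single_eq_U assoc_Delta_left_U Delta_right_U by (rule sum.swap)
  show ?thesis
    by (rule linear_eq_on_basis[where x = x,
          OF linear_comp[OF linear_assoc linear_comp[OF linear_tensor_map linear_Delta]]
          linear_comp[OF linear_tensor_map linear_Delta] basis])
qed

theorem theorem4p3:
  fixes n :: nat
  assumes "n > 1"
  shows "(\<forall>\<alpha>\<in>{0..n - 1}. coassociative (F n :: (nat \<times> nat \<Rightarrow>\<^sub>0 'k::field) set) (Delta n \<alpha>)) \<and>
    (\<forall>\<alpha>\<in>{0..n - 1}. \<forall>\<beta>\<in>{0..n - 1}.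
      entangled (F n :: (nat \<times> nat \<Rightarrow>\<^sub>0 'k) set) (Delta n \<alpha>) (Delta n \<beta>))"
  by (simp add: coassociative_def entangled_def Delta_entanglement)

end
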